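(* There exists $\varepsilon>0$ such that for all sufficiently large $n$ there is a protocol $\Pi$ for the game $G_n$ with cost $c(\Pi)\le(1-\varepsilon)\sqrt{n}$.
   Context: The game $G_n$ ($n$ a positive integer): Alice receives, as a stream, a permutation $\sigma=(\sigma_1,\dots,\sigma_n)$ of $[n]=\{1,\dots,n\}$ followed by a bit $b\in\{0,1\}$. She has an array $\mathbf{v}=(v_1,\dots,v_n)$ whose cells are initially empty. For each $i<n$, upon receiving $\sigma_i$ she writes a bit in cell $\sigma_i$; this bit may depend on $\sigma_1,\dots,\sigma_i$, and once written cannot be changed. Upon receiving $\sigma_n$ and $b$ she writes $b$ in cell $\sigma_n$. Bob receives the completed array $\mathbf{v}\in\{0,1\}^n$ and outputs a set $J\subseteq[n]$ as a function of $\mathbf{v}$. A protocol $\Pi$ (Alice's writing rule together with Bob's output map) is valid if $\sigma_n\in J$ for all $\sigma,b$; its cost $c(\Pi)$ is the maximum of $|J|$ over all $\sigma,b$. Protocols are required to be valid. *)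

theory Defs
  imports Complex_Main
begin

definition perms :: "nat \<Rightarrow> nat list set" where
  "perms n = {\<sigma>. distinct \<sigma> \<and> set \<sigma> = {1..n}}"

text \<open>Alice's writing rule: a map from the received prefix (sigma_1,...,sigma_i)
  to the bit written in cell sigma_i.  Bob's output map: from the completed array
  (a function on cells; cells outside [n] read as False) to a set of cells.\<close>
type_synonym alice = "nat list \<Rightarrow> bool"
type_synonym bob = "(nat \<Rightarrow> bool) \<Rightarrow> nat set"

definition fill :: "alice \<Rightarrow> nat list \<Rightarrow> bool \<Rightarrow> nat \<Rightarrow> bool" where
  "fill A \<sigma> b j =
     (if j = last \<sigma> then b
      else if j \<in> set \<sigma> then A (takeWhile (\<lambda>x. x \<noteq> j) \<sigma> @ [j])
      else False)"

definition protocol :: "nat \<Rightarrow> alice \<Rightarrow> bob \<Rightarrow> bool" where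
  "protocol n A B \<longleftrightarrow> (\<forall>v. B v \<subseteq> {1..n})"

definition valid :: "nat \<Rightarrow> alice \<Rightarrow> bob \<Rightarrow> bool" where
  "valid n A B \<longleftrightarrow> (\<forall>\<sigma>\<in>perms n. \<forall>b. last \<sigma> \<in> B (fill A \<sigma> b))"

definition cost :: "nat \<Rightarrow> alice \<Rightarrow> bob \<Rightarrow> nat" where
  "cost n A B = Max {card (B (fill A \<sigma> b)) | \<sigma> b. \<sigma> \<in> perms n}"

end

theory Submission
  imports Defs
begin

text \<open>Split the cells into blocks, so that only the final block can hold an adversarial last bit. If the
  last cell of a block is used to make the block deviate in one place from a code word of minimum
  distance 3, a finished block reveals its own last cell, while a block equal to a code word must
  be the final one. With six code words of length 6, one per cell, Alice can aim at the word of the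
  cell that arrives first in the block; this word then excludes that cell, so a block equal to a code
  word leaves only 5 candidates, and 5 blocks of 6 cells give a protocol for 30 cells of cost
  \<open>5 < sqrt 30\<close>. Two protocols compose to one whose size and cost are the products:
  Alice uses the last cell of each inner copy to let its parity be the bit of the outer protocol. Composing
  with the protocol of cost \<open>m\<close> for \<open>m\<^sup>2\<close> cells gives cost \<open>5 m\<close> for
  \<open>30 m\<^sup>2\<close> cells.\<close>

section \<open>The positional form of the game\<close>

text \<open>Since Bob sees only the final array, Alice may forget the order of the past cells:
  \<open>wins B v R\<close> is the positional game in which the cells of \<open>R\<close> are still to come.\<close>
inductive wins :: "(('a \<Rightarrow> bool) \<Rightarrow> 'a set) \<Rightarrow> ('a \<Rightarrow> bool) \<Rightarrow> 'a set \<Rightarrow> bool" for B where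
  last: "(\<And>b. i \<in> B (v(i := b))) \<Longrightarrow> wins B v {i}"
| step: "R \<noteq> {} \<Longrightarrow> (\<And>i. i \<in> R \<Longrightarrow> \<exists>b. wins B (v(i := b)) (R - {i})) \<Longrightarrow> wins B v R"

lemma wins_nonempty: "wins B v R \<Longrightarrow> R \<noteq> {}"
  by (induction rule: wins.induct) auto

text \<open>A single open cell can only come from the rule \<open>last\<close>: \<open>step\<close>
  would need a winning position with no open cell, which \<open>wins_nonempty\<close>
  excludes.\<close>

lemma wins_lastD: "wins B v {i} \<Longrightarrow> i \<in> B (v(i := b))"
  by (erule wins.cases) (auto dest: wins_nonempty)

lemma wins_stepD: "wins B v R \<Longrightarrow> i \<in> R \<Longrightarrow> R \<noteq> {i} \<Longrightarrow> \<exists>b. wins B (v(i := b)) (R - {i})"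
  by (erule wins.cases) auto

text \<open>Every open cell is overwritten before Bob reads the array, so its present value is
  irrelevant.\<close>

lemma wins_cong: "wins B v R \<Longrightarrow> (\<And>x. x \<notin> R \<Longrightarrow> v x = u x) \<Longrightarrow> wins B u R"
proof (induction arbitrary: u rule: wins.induct)
  case (last i v)
  have "u(i := b) = v(i := b)" for b
    using last.prems by (auto simp: fun_eq_iff)
  with last.hyps show ?case
    by (intro wins.last) metis
next
  case (step R v)
  have "\<exists>b. wins B (u(i := b)) (R - {i})" if "i \<in> R" for i
    using step.IH[OF that] step.prems by (metis DiffI fun_upd_apply singletonD)
  with step.hyps(1) show ?case
    by (rule wins.step)
qed

text \<open>The cells of \<open>R - R'\<close> are made to arrive first; Alice's winning replies to
  them leave some \<open>v'\<close> with exactly \<open>R'\<close> open. This turns a protocol for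
  many cells into one for fewer.\<close>

lemma wins_mono:
  assumes "finite (R - R')" "R' \<subseteq> R" "R' \<noteq> {}" "wins B v R"
  shows "\<exists>v'. wins B v' R'"
  using assms
proof (induction "R - R'" arbitrary: R v rule: finite_induct)
  case empty
  then show ?case by (metis Diff_eq_empty_iff subset_antisym)
next
  case (insert i F)
  then obtain b where "wins B (v(i := b)) (R - {i})"
    using wins_stepD[of B v R i] by (metis Diff_iff insertCI singletonD subset_singletonD)
  moreover have "F = R - {i} - R'" "R' \<subseteq> R - {i}"
    using insert by auto
  ultimately show ?case
    using insert by blast
qed

lemma wins_inj:
  assumes "inj_on f X" "finite X" "wins B u (f ` X)"
  obtains B' where "wins B' (\<lambda>_. False) X" "\<And>v. B' v \<subseteq> X" "\<And>v. \<exists>v'. f ` B' v \<subseteq> B v'"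
proof -
  define M where "M = (\<lambda>v y. if y \<in> f ` X then v (the_inv_into X f y) else u y)"
  define B' where "B' v = {x \<in> X. f x \<in> B (M v)}" for v
  have M: "M (v(i := b)) = (M v)(f i := b)" if "i \<in> X" for v i b
    using that assms(1) by (auto simp: M_def the_inv_into_f_f fun_eq_iff dest: inj_onD)
  have main: "wins B' v R"
    if "R \<subseteq> X" "wins B (M v) (f ` R)" for v R
    using finite_subset[OF that(1) assms(2)] that
  proof (induction R arbitrary: v rule: finite_psubset_induct)
    case (psubset R)
    have "R \<noteq> {}" using wins_nonempty[OF psubset.prems(2)] by auto
    show ?case
    proof (cases "\<exists>i. R = {i}")
      case True
      then obtain i where R: "R = {i}" by blast
      then have "i \<in> X" "wins B (M v) {f i}" using psubset.prems by auto
      then show ?thesis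
        unfolding R by (intro wins.last) (simp add: B'_def M wins_lastD del: fun_upd_apply)
    next
      case False
      show ?thesis
      proof (rule wins.step[OF \<open>R \<noteq> {}\<close>])
        fix i assume i: "i \<in> R"
        with False have "f ` R \<noteq> {f i}"
          using psubset.prems(1) assms(1) by (auto simp: inj_on_def image_def set_eq_iff subset_iff) metis
        then obtain b where "wins B ((M v)(f i := b)) (f ` R - {f i})"
          using wins_stepD[OF psubset.prems(2)] i by blast
        moreover have "f ` R - {f i} = f ` (R - {i})"
          using i psubset.prems(1) assms(1) by (auto simp: inj_on_def subset_iff)
        ultimately have "wins B (M (v(i := b))) (f ` (R - {i}))"
          using M[of i v b] i psubset.prems(1) by (simp add: subset_iff)
        moreover have "R - {i} \<subset> R" "R - {i} \<subseteq> X" using i psubset.prems(1) by auto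
        ultimately have "wins B' (v(i := b)) (R - {i})"
          by (intro psubset.IH)
        then show "\<exists>b. wins B' (v(i := b)) (R - {i})" ..
      qed
    qed
  qed
  have "wins B (M (\<lambda>_. False)) (f ` X)"
    by (rule wins_cong[OF assms(3)]) (auto simp: M_def)
  from main[OF subset_refl this] show ?thesis
    by (rule that) (auto simp: B'_def)
qed

section \<open>From winning positions to writing rules\<close>

definition move :: "(('a \<Rightarrow> bool) \<Rightarrow> 'a set) \<Rightarrow> ('a \<Rightarrow> bool) \<Rightarrow> 'a set \<Rightarrow> 'a \<Rightarrow> bool" where
  "move B v R i = (SOME b. wins B (v(i := b)) (R - {i}))"

text \<open>The list runs from the newest cell to the oldest, so \<open>X - set \<tau>\<close> is
  the set of cells open just before \<open>i\<close> arrives.\<close>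

primrec play :: "(('a \<Rightarrow> bool) \<Rightarrow> 'a set) \<Rightarrow> 'a set \<Rightarrow> 'a list \<Rightarrow> 'a \<Rightarrow> bool" where
  "play B X [] = (\<lambda>_. False)"
| "play B X (i # \<tau>) = (play B X \<tau>)(i := move B (play B X \<tau>) (X - set \<tau>) i)"

definition strategy :: "(('a \<Rightarrow> bool) \<Rightarrow> 'a set) \<Rightarrow> 'a set \<Rightarrow> 'a list \<Rightarrow> bool" where
  "strategy B X \<rho> = play B X (rev \<rho>) (last \<rho>)"

lemma wins_play:
  assumes "wins B (\<lambda>_. False) X"
  shows "distinct (\<rho> @ \<tau>) \<Longrightarrow> set (\<rho> @ \<tau>) = X \<Longrightarrow> \<tau> \<noteq> [] \<Longrightarrow> wins B (play B X (rev \<rho>)) (set \<tau>)"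
proof (induction \<rho> arbitrary: \<tau> rule: rev_induct)
  case Nil
  with assms show ?case by simp
next
  case (snoc i \<rho>)
  then have *: "wins B (play B X (rev \<rho>)) (set (i # \<tau>))"
    using snoc.prems by (intro snoc.IH) auto
  have "set (i # \<tau>) \<noteq> {i}" "set (i # \<tau>) - {i} = set \<tau>" "X - set \<rho> = set (i # \<tau>)"
    using snoc.prems by (cases \<tau>; auto)+
  with wins_stepD[OF *, of i] have "\<exists>b. wins B ((play B X (rev \<rho>))(i := b)) (set \<tau>)"
    by simp
  from someI_ex[OF this] show ?case
    using \<open>X - set \<rho> = set (i # \<tau>)\<close> \<open>set (i # \<tau>) - {i} = set \<tau>\<close> by (simp add: move_def del: fun_upd_apply)
qed

text \<open>When no cell repeats, an entry is never rewritten, so the bit in \<open>j\<close> is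
  determined by the prefix ending in \<open>j\<close>. This is the form in which \<open>fill\<close>
  consults Alice.\<close>

lemma play_strategy:
  "distinct \<rho> \<Longrightarrow> play B X (rev \<rho>) j =
     (if j \<in> set \<rho> then strategy B X (takeWhile (\<lambda>x. x \<noteq> j) \<rho> @ [j]) else False)"
proof (induction \<rho> rule: rev_induct)
  case Nil
  then show ?case by simp
next
  case (snoc i \<rho>)
  show ?case
  proof (cases "j = i")
    case True
    with snoc.prems have "takeWhile (\<lambda>x. x \<noteq> j) (\<rho> @ [i]) = \<rho>"
      by (auto simp: takeWhile_append)
    with True show ?thesis by (simp add: strategy_def)
  next
    case False
    with snoc show ?thesis by (auto simp: takeWhile_append)
  qed
qed

lemma fill_strategy:
  assumes "distinct (\<rho> @ [i])"
  shows "fill (strategy B X) (\<rho> @ [i]) b = (play B X (rev \<rho>))(i := b)"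
  using assms by (auto simp: fill_def fun_eq_iff play_strategy takeWhile_append)

lemma valid_strategy:
  assumes "wins B (\<lambda>_. False) {1..n}"
  shows "valid n (strategy B {1..n}) B"
  unfolding valid_def
proof (intro ballI allI)
  fix \<sigma> b assume \<sigma>: "\<sigma> \<in> perms n"
  then have "\<sigma> \<noteq> []"
    using wins_nonempty[OF assms] by (auto simp: perms_def)
  then obtain \<rho> i where [simp]: "\<sigma> = \<rho> @ [i]"
    by (metis rev_exhaust)
  have "wins B (play B {1..n} (rev \<rho>)) (set [i])"
    using \<sigma> by (intro wins_play[OF assms]) (auto simp: perms_def)
  with \<sigma> show "last \<sigma> \<in> B (fill (strategy B {1..n}) \<sigma> b)"
    by (auto simp: fill_strategy perms_def wins_lastD simp del: fun_upd_apply)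
qed

lemma cost_le:
  assumes "\<And>v. card (B v) \<le> c"
  shows "cost n A B \<le> c"
proof -
  let ?S = "{card (B (fill A \<sigma> b)) | \<sigma> b. \<sigma> \<in> perms n}"
  have "?S \<subseteq> {..c}" using assms by auto
  moreover from this have "finite ?S" by (rule finite_subset) simp
  \<comment> \<open>The increasing permutation makes the set of costs nonempty, so its
    \<open>Max\<close> is one of its elements.\<close>
  moreover have "[1..<Suc n] \<in> perms n" by (auto simp: perms_def)
  then have "?S \<noteq> {}" by blast
  ultimately show ?thesis
    unfolding cost_def by (metis (no_types, lifting) Max_in atMost_iff subsetD)
qed

text \<open>Cells may have any type, so that products can serve as cell sets. The cost bound is
  imposed on all arrays, not only on reachable ones, and thus survives composition and
  renaming.\<close>

definition solvable :: "'a set \<Rightarrow> nat \<Rightarrow> bool" where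
  "solvable V c \<longleftrightarrow> finite V \<and> (\<exists>B. (\<forall>v. B v \<subseteq> V \<and> card (B v) \<le> c) \<and> wins B (\<lambda>_. False) V)"

text \<open>Surplus cells are played in advance by \<open>wins_mono\<close>, and the remaining
  \<open>n\<close> are renamed to \<open>{1..n}\<close> by \<open>wins_inj\<close>.\<close>

lemma protocol_if_solvable:
  assumes "solvable V c" "0 < n" "n \<le> card V"
  shows "\<exists>A B. protocol n A B \<and> valid n A B \<and> cost n A B \<le> c"
proof -
  obtain B where V: "finite V" and B: "\<And>v. B v \<subseteq> V" "\<And>v. card (B v) \<le> c" and w: "wins B (\<lambda>_. False) V"
    using assms(1) by (auto simp: solvable_def)
  obtain f where f: "inj_on f {1..n}" "f ` {1..n} \<subseteq> V"
    using card_le_inj[of "{1..n}" V] V assms(3) by auto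
  have "finite (V - f ` {1..n})" "f ` {1..n} \<noteq> {}" using V assms(2) by auto
  from wins_mono[OF this(1) f(2) this(2) w] obtain u where "wins B u (f ` {1..n})" ..
  from wins_inj[OF f(1) finite_atLeastAtMost this] obtain B' where
    B': "wins B' (\<lambda>_. False) {1..n}" "\<And>v. B' v \<subseteq> {1..n}" "\<And>v. \<exists>v'. f ` B' v \<subseteq> B v'"
    by metis
  have "card (B' v) \<le> c" for v
  proof -
    obtain v' where v': "f ` B' v \<subseteq> B v'" using B'(3) by blast
    have "card (B' v) = card (f ` B' v)"
      using card_image[OF inj_on_subset[OF f(1) B'(2)]] by simp
    also have "\<dots> \<le> card (B v')"
      using finite_subset[OF B(1) V] v' by (rule card_mono)
    also have "\<dots> \<le> c" by (rule B(2))
    finally show ?thesis .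
  qed
  then have "cost n (strategy B' {1..n}) B' \<le> c" by (rule cost_le)
  moreover have "protocol n (strategy B' {1..n}) B'" using B'(2) by (simp add: protocol_def)
  ultimately show ?thesis using valid_strategy[OF B'(1)] by blast
qed

section \<open>Composition of protocols\<close>

definition slice :: "'b set \<Rightarrow> ('a \<times> 'b \<Rightarrow> bool) \<Rightarrow> 'a \<Rightarrow> 'b set" where
  "slice W v p = {q \<in> W. v (p, q)}"

definition flip :: "'a \<Rightarrow> 'a set \<Rightarrow> 'a set" where
  "flip q S = (if q \<in> S then S - {q} else insert q S)"

lemma flip_flip [simp]: "flip q (flip q S) = S"
  by (auto simp: flip_def)

lemma minus_singleton_eq_cases: "S - {q} = t - {q} \<Longrightarrow> S = t \<or> S = flip q t"
  unfolding flip_def by (cases "q \<in> S"; cases "q \<in> t") (auto simp: insert_absorb)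

lemma slice_upd_other [simp]: "p' \<noteq> p \<Longrightarrow> slice W (v((p, q) := b)) p' = slice W v p'"
  by (auto simp: slice_def)

lemma slice_upd_minus [simp]: "slice W (v((p, q) := b)) p - {q} = slice W v p - {q}"
  by (auto simp: slice_def)

lemma slice_upd_same:
  "q \<in> W \<Longrightarrow> slice W (v((p, q) := b)) p = (if b then insert q (slice W v p) else slice W v p - {q})"
  by (auto simp: slice_def)

text \<open>Each \<open>p\<close> in \<open>U\<close> carries an inner copy of the game on
  \<open>W\<close>, whose parity is the bit of the outer cell \<open>p\<close>. The outer Bob
  selects at most \<open>c\<close> copies, and the inner Bob at most \<open>d\<close> cells in
  each.\<close>

lemma solvable_prod:
  assumes "solvable U c" "solvable W d"
  shows "solvable (U \<times> W) (c * d)"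
proof -
  obtain B1 where U: "finite U" and B1: "\<And>v. B1 v \<subseteq> U" "\<And>v. card (B1 v) \<le> c" and w1: "wins B1 (\<lambda>_. False) U"
    using assms(1) by (auto simp: solvable_def)
  obtain B2 where W: "finite W" and B2: "\<And>v. B2 v \<subseteq> W" "\<And>v. card (B2 v) \<le> d" and w2: "wins B2 (\<lambda>_. False) W"
    using assms(2) by (auto simp: solvable_def)
  define par where "par v = (\<lambda>p. odd (card (slice W v p)))" for v :: "'a \<times> 'b \<Rightarrow> bool"
  define B where "B v = Sigma (B1 (par v)) (\<lambda>p. B2 (\<lambda>q. v (p, q)))" for v
  have par_other: "par (v((p, q) := b)) p' = par v p'" if "p' \<noteq> p" for v p q b p'
    using that by (simp add: par_def)
  have par_surj: "\<exists>b. par (v((p, q) := b)) p = a" if "q \<in> W" for v p q a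
  proof -
    have "finite (slice W v p)" using W by (simp add: slice_def)
    then have "par (v((p, q) := True)) p \<noteq> par (v((p, q) := False)) p"
      using that by (cases "q \<in> slice W v p")
        (auto simp: par_def slice_upd_same card_insert_if card_Diff_singleton_if)
    then show ?thesis by (metis (full_types))
  qed
  \<comment> \<open>Invariant: the parities form a winning outer position whose open cells are the
    copies with a cell still to come, and each such copy is in a winning inner position.\<close>
  have main: "wins B v R"
    if "R \<subseteq> U \<times> W" "wins B1 (par v) (fst ` R)"
      "\<And>p. p \<in> fst ` R \<Longrightarrow> wins B2 (\<lambda>q. v (p, q)) {q. (p, q) \<in> R}" for v R
    using finite_subset[OF that(1) finite_cartesian_product[OF U W]] that
  proof (induction R arbitrary: v rule: finite_psubset_induct)
    case (psubset R)
    let ?inner = "\<lambda>p. {q. (p, q) \<in> R}"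
    have "R \<noteq> {}" using wins_nonempty[OF psubset.prems(2)] by auto
    show ?case
    proof (cases "\<exists>p q. R = {(p, q)}")
      case True
      then obtain p q where R: "R = {(p, q)}" by blast
      \<comment> \<open>The adversarial bit changes only the parity of \<open>p\<close>, so for the
        outer game it acts as an arbitrary last bit in cell \<open>p\<close>.\<close>
      have "p \<in> B1 (par (v((p, q) := b)))" for b
      proof -
        have "par (v((p, q) := b)) = (par v)(p := par (v((p, q) := b)) p)"
          by (auto simp: fun_eq_iff par_other)
        with psubset.prems(2) show ?thesis
          by (metis R fst_conv image_empty image_insert wins_lastD)
      qed
      moreover have "q \<in> B2 (\<lambda>q'. (v((p, q) := b)) (p, q'))" for b
      proof -
        have "(\<lambda>q'. (v((p, q) := b)) (p, q')) = (\<lambda>q'. v (p, q'))(q := b)" by auto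
        moreover have "wins B2 (\<lambda>q. v (p, q)) {q}" using psubset.prems(3)[of p] by (simp add: R)
        ultimately show ?thesis by (simp add: wins_lastD del: fun_upd_apply)
      qed
      ultimately show ?thesis
        unfolding R by (intro wins.last) (auto simp: B_def simp del: fun_upd_apply)
    next
      case False
      show ?thesis
      proof (rule wins.step[OF \<open>R \<noteq> {}\<close>])
        fix i assume "i \<in> R"
        then obtain p q where i: "i = (p, q)" "(p, q) \<in> R" "p \<in> U" "q \<in> W" "p \<in> fst ` R"
          using psubset.prems(1) by force
        have upd_inner: "(\<lambda>q'. (v((p, q) := b)) (p, q')) = (\<lambda>q'. v (p, q'))(q := b)" for b by auto
        have "\<exists>b. wins B1 (par (v((p, q) := b))) (fst ` (R - {(p, q)})) \<and>
          (p \<in> fst ` (R - {(p, q)}) \<longrightarrow> wins B2 (\<lambda>q'. (v((p, q) := b)) (p, q')) (?inner p - {q}))"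
        \<comment> \<open>If \<open>q\<close> closes its copy, that inner game no longer matters and
          the bit is free to set the parity. Otherwise the inner strategy picks the bit; the parity
          of \<open>p\<close> may change, but \<open>p\<close> is still open in the outer
          game.\<close>
        proof (cases "?inner p = {q}")
          case True
          then have iff: "(p, q') \<in> R \<longleftrightarrow> q' = q" for q' by blast
          then have fst_R: "fst ` (R - {(p, q)}) = fst ` R - {p}" by force
          have "fst ` R \<noteq> {p}"
          proof
            assume *: "fst ` R = {p}"
            have "x \<in> R \<longleftrightarrow> x = (p, q)" for x
              using * iff imageI[of x R fst] by (cases x) auto
            with False show False by blast
          qed
          then obtain a where a: "wins B1 ((par v)(p := a)) (fst ` R - {p})"
            using wins_stepD[OF psubset.prems(2)] i by blast
          obtain b where "par (v((p, q) := b)) p = a" using par_surj i by blast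
          then have "par (v((p, q) := b)) = (par v)(p := a)"
            by (auto simp: fun_eq_iff par_other)
          with a show ?thesis
            unfolding fst_R by (intro exI[of _ b]) auto
        next
          case ne: False
          then obtain b where b: "wins B2 ((\<lambda>q'. v (p, q'))(q := b)) (?inner p - {q})"
            using wins_stepD[OF psubset.prems(3)[OF i(5)]] i by blast
          have "fst ` (R - {(p, q)}) = fst ` R"
          proof -
            obtain q' where "q' \<noteq> q" "(p, q') \<in> R" using ne i(2) by blast
            then have "p \<in> fst ` (R - {(p, q)})" by (intro image_eqI[of _ _ "(p, q')"]) auto
            moreover have "fst ` R \<subseteq> insert p (fst ` (R - {(p, q)}))" by force
            ultimately show ?thesis by blast
          qed
          moreover have "wins B1 (par (v((p, q) := b))) (fst ` R)"
            by (rule wins_cong[OF psubset.prems(2)]) (use i(5) in \<open>metis par_other\<close>)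
          ultimately show ?thesis
            using b by (auto simp: upd_inner simp del: fun_upd_apply)
        qed
        then obtain b where b: "wins B1 (par (v((p, q) := b))) (fst ` (R - {(p, q)}))"
          "p \<in> fst ` (R - {(p, q)}) \<Longrightarrow> wins B2 (\<lambda>q'. (v((p, q) := b)) (p, q')) (?inner p - {q})"
          by blast
        have "wins B (v((p, q) := b)) (R - {(p, q)})"
        proof (rule psubset.IH)
          fix p' assume p': "p' \<in> fst ` (R - {(p, q)})"
          show "wins B2 (\<lambda>q'. (v((p, q) := b)) (p', q')) {q'. (p', q') \<in> R - {(p, q)}}"
          proof (cases "p' = p")
            case True
            then have "{q'. (p', q') \<in> R - {(p, q)}} = ?inner p - {q}" by auto
            with b(2) p' True show ?thesis by simp
          next
            case False
            with p' psubset.prems(3)[of p'] show ?thesis by auto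
          qed
        next
          show "R - {(p, q)} \<subset> R" using i(2) by blast
          show "R - {(p, q)} \<subseteq> U \<times> W" using psubset.prems(1) by blast
        qed (fact b(1))
        then show "\<exists>b. wins B (v(i := b)) (R - {i})" by (auto simp: i(1))
      qed
    qed
  qed
  have "W \<noteq> {}" using wins_nonempty[OF w2] .
  then have "fst ` (U \<times> W) = U" by auto
  moreover have "par (\<lambda>_. False) = (\<lambda>_. False)" by (simp add: par_def slice_def)
  ultimately have "wins B (\<lambda>_. False) (U \<times> W)"
    using w1 w2 by (intro main) auto
  moreover have "B v \<subseteq> U \<times> W" for v
    using B1(1) B2(1) by (auto simp: B_def subset_iff)
  moreover have "card (B v) \<le> c * d" for v
  proof -
    have "card (B v) = (\<Sum>p\<in>B1 (par v). card (B2 (\<lambda>q. v (p, q))))"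
      unfolding B_def using finite_subset[OF B1(1) U] finite_subset[OF B2(1) W]
      by (intro card_SigmaI) auto
    also have "\<dots> \<le> card (B1 (par v)) * d"
      using sum_bounded_above[of "B1 (par v)" "\<lambda>p. card (B2 (\<lambda>q. v (p, q)))" d] B2(2) by simp
    also have "\<dots> \<le> c * d" using B1(2) by simp
    finally show ?thesis .
  qed
  ultimately show ?thesis
    using U W unfolding solvable_def by blast
qed

section \<open>Blocks and codes of minimum distance 3\<close>

text \<open>\<open>U\<close> indexes the blocks, \<open>T\<close> is the code, and
  \<open>D w\<close> lists the possible last cells of a block that equals \<open>w\<close>. By the
  last assumption, the first arrival \<open>q\<close> in a block can fix a target word whose
  candidates contain all later cells. The same \<open>c\<close> bounds both outputs of Bob:
  \<open>D w\<close> in one block, or one cell per block.\<close>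

lemma solvable_code_blocks:
  fixes D :: "'b set \<Rightarrow> 'b set" and U :: "'a set"
  assumes U: "finite U" "U \<noteq> {}" "card U \<le> c" and W: "finite W" "2 \<le> card W"
    and dist: "\<And>w w'. w \<in> T \<Longrightarrow> w' \<in> T \<Longrightarrow> w \<noteq> w' \<Longrightarrow> 3 \<le> card (sym_diff w w')"
    and T: "\<And>w. w \<in> T \<Longrightarrow> w \<subseteq> W"
    and D: "\<And>w. w \<in> T \<Longrightarrow> D w \<subseteq> W \<and> card (D w) \<le> c"
      "\<And>q. q \<in> W \<Longrightarrow> \<exists>w\<in>T. W - {q} \<subseteq> D w"
  shows "solvable (U \<times> W) c"
proof -
  have code: "flip q w \<notin> T" if "w \<in> T" for w q
  proof
    assume "flip q w \<in> T"
    then have "3 \<le> card (sym_diff w (flip q w))"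
      using that by (intro dist) (auto simp: flip_def)
    also have "\<dots> \<le> card {q}"
      by (intro card_mono) (auto simp: flip_def split: if_splits)
    finally show False by simp
  qed
  have flip_unique: "q = q'" if "w \<in> T" "w' \<in> T" "flip q w = flip q' w'" for w w' q q'
  proof (cases "w = w'")
    case True
    with that(3) show ?thesis by (auto simp: flip_def split: if_splits)
  next
    case False
    have "sym_diff w w' \<subseteq> {q, q'}"
      using that(3) by (auto simp: flip_def split: if_splits)
    then have "card (sym_diff w w') \<le> card {q, q'}"
      by (intro card_mono) auto
    also have "\<dots> \<le> 2" by (simp add: card_insert_if)
    finally show ?thesis using dist[OF that(1,2) False] by linarith
  qed
  \<comment> \<open>An arbitrary array may have several blocks in \<open>T\<close>;
    \<open>SOME\<close> keeps a single one, so the cost bound holds for it as well. If no block is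
    in \<open>T\<close>, each contributes the cell whose flip gives a code word.\<close>
  define B where "B v =
    (if \<exists>p\<in>U. slice W v p \<in> T then
       let p = SOME p. p \<in> U \<and> slice W v p \<in> T in {p} \<times> D (slice W v p)
     else {(p, q) \<in> U \<times> W. flip q (slice W v p) \<in> T})" for v :: "'a \<times> 'b \<Rightarrow> bool"
  define inner where "inner R p = {q. (p, q) \<in> R}" for R :: "('a \<times> 'b) set" and p
  \<comment> \<open>The three states of a block with open cells \<open>S\<close>: untouched, finished, in progress.\<close>
  define ok where "ok v S p \<longleftrightarrow> S = W \<or>
    (if S = {} then \<exists>t\<in>T. \<exists>q\<in>W. slice W v p = flip q t
     else \<exists>t\<in>T. S \<subseteq> D t \<and> slice W v p - S = t - S)" for v :: "'a \<times> 'b \<Rightarrow> bool" and S p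
  have main: "wins B v R"
    if "R \<subseteq> U \<times> W" "R \<noteq> {}" "\<And>p. p \<in> U \<Longrightarrow> ok v (inner R p) p" for v R
    using finite_subset[OF that(1) finite_cartesian_product[OF U(1) W(1)]] that
  proof (induction R arbitrary: v rule: finite_psubset_induct)
    case (psubset R)
    show ?case
    proof (cases "\<exists>p q. R = {(p, q)}")
      case True
      then obtain p q where R: "R = {(p, q)}" by blast
      then have p: "p \<in> U" "q \<in> W" using psubset.prems(1) by auto
      have "inner R p = {q}" by (auto simp: R inner_def)
      \<comment> \<open>Because \<open>W\<close> has at least two cells, a block with one open cell
        is not untouched and already has a target word.\<close>
      moreover from this have "inner R p \<noteq> W" using W(2) by auto
      ultimately obtain t where t: "t \<in> T" "q \<in> D t" "slice W v p - {q} = t - {q}"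
        using psubset.prems(3)[OF p(1)] by (auto simp: ok_def)
      have other: "slice W (v((p, q) := b)) p' \<notin> T" if p': "p' \<in> U" "p' \<noteq> p" for p' b
      proof -
        have "inner R p' = {}" using p' by (auto simp: R inner_def)
        then obtain t' q' where "t' \<in> T" "q' \<in> W" "slice W v p' = flip q' t'"
          using psubset.prems(3)[OF p'(1)] W(2) by (auto simp: ok_def)
        with p' code show ?thesis by simp
      qed
      have "(p, q) \<in> B (v((p, q) := b))" for b
      proof -
        let ?v = "v((p, q) := b)"
        have "slice W ?v p - {q} = t - {q}" using t(3) by (simp del: fun_upd_apply)
        \<comment> \<open>The adversary either completes the target word, so that \<open>p\<close>
          is the only block in \<open>T\<close>, or leaves \<open>p\<close> flipped at
          \<open>q\<close> like a finished block.\<close>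
        from minus_singleton_eq_cases[OF this]
        consider "slice W ?v p = t" | "slice W ?v p = flip q t" by blast
        then show ?thesis
        proof cases
          case 1
          have "(SOME p. p \<in> U \<and> slice W ?v p \<in> T) = p"
            by (rule some_equality) (use 1 t(1) p(1) other in blast)+
          moreover have "\<exists>p\<in>U. slice W ?v p \<in> T" using 1 t(1) p(1) by metis
          ultimately show ?thesis
            using t(2) 1 unfolding B_def Let_def by simp
        next
          case 2
          then have "slice W ?v p \<notin> T" using code t(1) by simp
          then have "\<not> (\<exists>p\<in>U. slice W ?v p \<in> T)" using other by metis
          with 2 t(1) p show ?thesis unfolding B_def by simp
        qed
      qed
      then show ?thesis unfolding R by (rule wins.last)
    next
      case False
      show ?thesis
      proof (rule wins.step[OF \<open>R \<noteq> {}\<close>])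
        fix i assume "i \<in> R"
        then obtain p q where i: "i = (p, q)" "(p, q) \<in> R" "p \<in> U" "q \<in> W"
          using psubset.prems(1) by force
        have S: "q \<in> inner R p" "inner R p \<subseteq> W"
          using i psubset.prems(1) by (auto simp: inner_def)
        \<comment> \<open>The target word: chosen now according to \<open>q\<close> if the block is
          untouched, and inherited from the invariant otherwise.\<close>
        obtain t where t: "t \<in> T" "inner R p - {q} \<subseteq> D t" "slice W v p - inner R p = t - inner R p"
        proof (cases "inner R p = W")
          case True
          moreover obtain w where w: "w \<in> T" "W - {q} \<subseteq> D w" using D(2)[OF i(4)] by blast
          moreover have "slice W v p - W = w - W" using T[OF w(1)] by (auto simp: slice_def)
          ultimately show ?thesis using that by metis
        next
          case False
          with psubset.prems(3)[OF i(3)] S that show ?thesis by (auto simp: ok_def split: if_splits)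
        qed
        \<comment> \<open>The bit of the target word is copied, but inverted when \<open>q\<close>
          is the last cell of its block.\<close>
        define b where "b = ((q \<in> t) \<noteq> (inner R p = {q}))"
        have b: "slice W (v((p, q) := b)) p - (inner R p - {q}) = t - (inner R p - {q})"
          if "inner R p \<noteq> {q}"
          using t(3) S that i(4) by (auto simp: b_def slice_upd_same)
        have b': "slice W (v((p, q) := b)) p = flip q t" if "inner R p = {q}"
          using t(3) S that i(4) by (auto simp: b_def slice_upd_same flip_def)
        have "wins B (v((p, q) := b)) (R - {(p, q)})"
        proof (rule psubset.IH)
          fix p' assume p': "p' \<in> U"
          show "ok (v((p, q) := b)) (inner (R - {(p, q)}) p') p'"
          proof (cases "p' = p")
            case True
            have "inner (R - {(p, q)}) p = inner R p - {q}" by (auto simp: inner_def)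
            moreover have "ok (v((p, q) := b)) (inner R p - {q}) p"
            proof (cases "inner R p = {q}")
              case True
              then have "\<exists>t\<in>T. \<exists>q'\<in>W. slice W (v((p, q) := b)) p = flip q' t"
                using b' t(1) i(4) by blast
              with True show ?thesis by (simp add: ok_def del: fun_upd_apply)
            next
              case False
              then have "inner R p - {q} \<noteq> {}" using S(1) by blast
              moreover have "\<exists>t\<in>T. inner R p - {q} \<subseteq> D t \<and>
                  slice W (v((p, q) := b)) p - (inner R p - {q}) = t - (inner R p - {q})"
                using b[OF False] t(1,2) by blast
              ultimately show ?thesis unfolding ok_def by (simp only: if_False simp_thms)
            qed
            ultimately show ?thesis using True by (simp only:)
          next
            case False
            then have "inner (R - {(p, q)}) p' = inner R p'" by (auto simp: inner_def)
            with psubset.prems(3)[OF p'] show ?thesis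
              by (simp only: ok_def slice_upd_other[OF False])
          qed
        next
          show "R - {(p, q)} \<noteq> {}" using False i(2) by auto
        qed (use i psubset.prems(1) in auto)
        then show "\<exists>b. wins B (v(i := b)) (R - {i})" by (auto simp: i(1))
      qed
    qed
  qed
  have "inner (U \<times> W) p = W" if "p \<in> U" for p using that by (auto simp: inner_def)
  moreover have "W \<noteq> {}" using W(2) by auto
  ultimately have "wins B (\<lambda>_. False) (U \<times> W)"
    using U by (intro main) (auto simp: ok_def)
  moreover have "B v \<subseteq> U \<times> W \<and> card (B v) \<le> c" for v
  proof (cases "\<exists>p\<in>U. slice W v p \<in> T")
    case True
    then have "(SOME p. p \<in> U \<and> slice W v p \<in> T) \<in> U \<and> slice W v (SOME p. p \<in> U \<and> slice W v p \<in> T) \<in> T"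
      by (metis (mono_tags, lifting) someI_ex)
    then obtain p where "p \<in> U" "slice W v p \<in> T" "B v = {p} \<times> D (slice W v p)"
      using True unfolding B_def Let_def by auto
    with D(1)[of "slice W v p"] show ?thesis
      by (auto simp: card_cartesian_product_singleton)
  next
    case False
    then have B: "B v = {(p, q) \<in> U \<times> W. flip q (slice W v p) \<in> T}" by (simp only: B_def if_False)
    \<comment> \<open>Two flips into \<open>T\<close> from the same block would give code words at
      distance at most 2.\<close>
    have "q = q'" if "(p, q) \<in> B v" "(p, q') \<in> B v" for p q q'
      using that flip_unique[of "flip q (slice W v p)" "flip q' (slice W v p)" q q'] by (simp add: B)
    then have "inj_on fst (B v)" by (auto simp: inj_on_def)
    then have "card (B v) \<le> card U"
      by (rule card_inj_on_le) (use U B in auto)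
    with U(3) show ?thesis by (auto simp: B)
  qed
  ultimately show ?thesis
    using U W unfolding solvable_def by auto
qed

section \<open>The two building blocks\<close>

text \<open>The code is the single word \<open>{}\<close>: only the last cell of each finished block
  holds a 1. The distance condition is then vacuous.\<close>

lemma solvable_square:
  assumes "2 \<le> m"
  shows "solvable ({..<m} \<times> {..<m}) m"
  by (rule solvable_code_blocks[where T = "{{}}" and D = "\<lambda>_. {..<m}"])
    (use assms in \<open>auto simp: flip_def lessThan_empty_iff\<close>)

text \<open>With \<open>0\<close> to \<open>5\<close> as the edges of the complete graph on four
  vertices, these are six of its eight edge cuts: the four vertex stars, the empty cut and one
  4-cycle. Cuts are closed under symmetric difference, and a nonempty one has at least 3
  edges.\<close>

definition code6 :: "nat \<Rightarrow> nat set" where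
  "code6 j = [{0,1,2}, {0,3,4}, {1,3,5}, {2,4,5}, {}, {1,2,3,4}] ! j"

lemma code6_dist:
  assumes "i < 6" "j < 6" "i \<noteq> j"
  shows "3 \<le> card (sym_diff (code6 i) (code6 j))"
proof -
  have "i \<in> {0,1,2,3,4,5}" "j \<in> {0,1,2,3,4,5}" using assms by auto
  with assms(3) show ?thesis
    by (elim insertE emptyE) (simp_all add: code6_def insert_Diff_if del: One_nat_def)
qed

lemma code6_subset:
  assumes "i < 6"
  shows "code6 i \<subseteq> {..<6}"
proof -
  have "i \<in> {0,1,2,3,4,5}" using assms by auto
  then show ?thesis by (elim insertE emptyE) (simp_all add: code6_def)
qed

text \<open>The words are pairwise distinct, so \<open>D (code6 q)\<close> is \<open>{..<6}\<close>
  without \<open>q\<close>: it has 5 elements and suits a block in which \<open>q\<close> arrives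
  first.\<close>

lemma solvable_30: "solvable ({..<5::nat} \<times> {..<6::nat}) 5"
proof (rule solvable_code_blocks[where T = "code6 ` {..<6}" and D = "\<lambda>w. {j \<in> {..<6}. code6 j \<noteq> w}"])
  fix w assume "w \<in> code6 ` {..<6}"
  then obtain i where i: "i < 6" "w = code6 i" by auto
  then have "card {j \<in> {..<6}. code6 j \<noteq> w} \<le> card ({..<6} - {i})"
    by (intro card_mono) auto
  with i show "{j \<in> {..<6}. code6 j \<noteq> w} \<subseteq> {..<6} \<and> card {j \<in> {..<6}. code6 j \<noteq> w} \<le> 5"
    by auto
next
  fix q :: nat assume "q \<in> {..<6}"
  then have "code6 j \<noteq> code6 q" if "j < 6" "j \<noteq> q" for j
    using code6_dist[of j q] that by auto
  then show "\<exists>w\<in>code6 ` {..<6}. {..<6} - {q} \<subseteq> {j \<in> {..<6}. code6 j \<noteq> w}"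
    using \<open>q \<in> {..<6}\<close> by (intro bexI[of _ "code6 q"]) auto
next
  fix w w' assume "w \<in> code6 ` {..<6}" "w' \<in> code6 ` {..<6}" "w \<noteq> w'"
  then show "3 \<le> card (sym_diff w w')" using code6_dist by blast
qed (use code6_subset in \<open>auto simp: lessThan_empty_iff\<close>)

section \<open>Choice of parameters\<close>

theorem theorem5:
  shows "\<exists>\<epsilon>::real. \<epsilon> > 0 \<and> (\<exists>N. \<forall>n\<ge>N.
           \<exists>A B. protocol n A B \<and> valid n A B \<and>
                 real (cost n A B) \<le> (1 - \<epsilon>) * sqrt (real n))"
proof -
  have "\<exists>A B. protocol n A B \<and> valid n A B \<and> real (cost n A B) \<le> (1 - 1/100) * sqrt n"
    if n: "10000 \<le> n" for n
  proof -
    \<comment> \<open>The least \<open>m\<close> with \<open>30 * m^2\<close> at least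
      \<open>n\<close>; the excess cells are discarded by
      \<open>protocol_if_solvable\<close>.\<close>
    define m where "m = nat \<lceil>sqrt (n / 30)\<rceil>"
    have "0 \<le> sqrt (n / 30)" by simp
    then have m: "sqrt (n / 30) \<le> m" "m \<le> sqrt (n / 30) + 1"
      unfolding m_def by linarith+
    have "n / 30 \<le> real m ^ 2"
      using m(1) by (rule sqrt_le_D)
    then have "real n \<le> real (30 * (m * m))" by (simp add: power2_eq_square)
    then have n_le: "n \<le> 30 * (m * m)" by (simp only: of_nat_le_iff)
    have "2 \<le> m"
    proof (rule ccontr)
      assume "\<not> 2 \<le> m"
      then have "m = 0 \<or> m = 1" by linarith
      with n n_le show False by auto
    qed
    then have "solvable (({..<5::nat} \<times> {..<6::nat}) \<times> ({..<m} \<times> {..<m})) (5 * m)"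
      by (intro solvable_prod solvable_30 solvable_square)
    from protocol_if_solvable[OF this, of n] n n_le
    obtain A B where AB: "protocol n A B" "valid n A B" "cost n A B \<le> 5 * m"
      by (auto simp: card_cartesian_product)
    \<comment> \<open>\<open>0.1826\<close> slightly exceeds \<open>1 / sqrt 30\<close>. Hence
      \<open>5 * m\<close> is at most \<open>0.913 * sqrt n + 5\<close>, and \<open>5\<close> is at
      most \<open>0.05 * sqrt n\<close> once \<open>n\<close> reaches \<open>10000\<close>; the
      total stays below \<open>0.99 * sqrt n\<close>.\<close>
    have "sqrt (n / 30) \<le> 1826 / 10000 * sqrt n"
      by (rule real_le_lsqrt) (auto simp: power_mult_distrib field_simps)
    moreover have "100 \<le> sqrt n" using n by (intro real_le_rsqrt) auto
    ultimately have "real (5 * m) \<le> (1 - 1/100) * sqrt n" using m(2) by (simp add: field_simps)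
    with AB(3) have "real (cost n A B) \<le> (1 - 1/100) * sqrt n" by linarith
    with AB show ?thesis by blast
  qed
  then have "\<forall>n\<ge>10000. \<exists>A B. protocol n A B \<and> valid n A B \<and> real (cost n A B) \<le> (1 - 1/100) * sqrt n"
    by blast
  moreover have "(1/100::real) > 0" by simp
  ultimately show ?thesis
    by (intro exI[of _ "1/100::real"] conjI exI[of _ "10000::nat"])
qed

end
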